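(* Let $H$ be a finite-dimensional real Hilbert space and let $f:H\to\mathbb{R}$ be convex, twice continuously differentiable and bounded below, with nonempty set of minimizers $X_\star$ and minimal value $f_\star$. Assume that for some $L_\nu>0$ and $\nu\in[0,1]$ one has $\|\nabla^2 f(x)-\nabla^2 f(y)\|\le L_\nu\|x-y\|^\nu$ for all $x,y\in H$, and that $D:=\sup\{\operatorname{dist}(x,X_\star): x\in H,\ f(x)\le f(x_0)\}<\infty$. Consider a fixed $k$-th iteration of the parameterized quadratic trust-region framework (described in the context) started at $x_0$, with current iterate $x_k\in H$. Let $\alpha:=\frac{1}{1+\nu}$, $C_f:=\frac{L_\nu}{(1+\nu)(2+\nu)}$ and $$\beta:=\min\left\{\frac{D}{F_0^\alpha},\left(\frac{1-\eta_2}{2C_fD}\right)^\alpha\right\}.$$ For a trial radius $\Delta>0$ let $s_k(\Delta)$ denote a global minimizer of $$\min_{\|s\|\le\Delta}m_k(s),\qquad m_k(s)=f(x_k)+\langle\nabla f(x_k),s\rangle+\tfrac12\langle\nabla^2 f(x_k)s,s\rangle.$$ Then $$m_k(0)-m_k(s_k(\Delta))\ge\frac{(1+\eta_2)F_k}{2D}\min\left\{\beta F_k^\alpha,\Delta\right\}.$$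
   Context: Write $F_k:=f(x_k)-f_\star$ and $g_k:=\nabla f(x_k)$. Parameterized quadratic trust-region framework. Inputs: $x_0\in H$, $\Delta_0>0$, $\vartheta\ge0$, constants $0<\eta_1\le\eta_2<1$, $0<\gamma_1\le\gamma_2<1\le\gamma_3$. For $k=0,1,2,\dots$: if $\|g_k\|=0$, terminate and return $x_k$. Otherwise compute a step $s_k$ with $\|s_k\|\le\Delta_k$ according to one of two variants. Variant I: $\vartheta=0$ and $m_k(0)-m_k(s_k)\ge\frac1{1+\tau_k}(m_k(0)-m_k(s_k^\star))$ with $s_k^\star\in\arg\min_{\|s\|\le\Delta_k}m_k(s)$, where $\tau_k\in[0,\bar\tau)$ for a given $\bar\tau>0$. Variant II: $\vartheta>0$ and $s_k\in\arg\min_{\|s\|\le\Delta_k}m_k(s)$. Set $$\rho_k^\vartheta:=\frac{f(x_k)-f(x_k+s_k)}{m_k(0)-m_k(s_k)+\frac{\vartheta}{2}\min\{\|\nabla f(x_k)\|,\|\nabla f(x_k+s_k)\|\}\|s_k\|}.$$ Set $x_{k+1}=x_k+s_k$ if $\rho_k^\vartheta\ge\eta_1$ and $x_{k+1}=x_k$ otherwise. Choose $\Delta_{k+1}$ arbitrarily in $[\gamma_1\Delta_k,\gamma_2\Delta_k]$ if $\rho_k^\vartheta<\eta_1$, in $[\gamma_2\Delta_k,\Delta_k]$ if $\eta_1\le\rho_k^\vartheta<\eta_2$, and in $[\Delta_k,\gamma_3\Delta_k]$ if $\rho_k^\vartheta\ge\eta_2$. (The objective values $f(x_k)$ are nonincreasing,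 since accepted steps decrease $f$.) Standing convention: the method does not terminate finitely, i.e. $\|\nabla f(x_k)\|>0$ and $F_k>0$ for all $k$ (so in particular $D>0$ and $\beta$ is well defined). *)

theory Defs
  imports "HOL-Analysis.Analysis"
begin

definition grad :: "('a::euclidean_space \<Rightarrow> real) \<Rightarrow> 'a \<Rightarrow> 'a" where
  "grad f x = (THE g. GDERIV f x :> g)"

(* The norm on the type of bounded linear maps is the operator norm. *)
definition hess :: "('a::euclidean_space \<Rightarrow> real) \<Rightarrow> 'a \<Rightarrow> 'a \<Rightarrow>\<^sub>L 'a" where
  "hess f x = (THE A. (grad f has_derivative blinfun_apply A) (at x))"

definition twice_cont_diff :: "('a::euclidean_space \<Rightarrow> real) \<Rightarrow> bool" where
  "twice_cont_diff f \<longleftrightarrow>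
     (\<forall>x. f differentiable (at x)) \<and>
     (\<forall>x. grad f differentiable (at x)) \<and>
     continuous_on UNIV (hess f)"

definition minimizers :: "('a \<Rightarrow> real) \<Rightarrow> 'a set" where
  "minimizers f = {x. is_arg_min f (\<lambda>_. True) x}"

definition min_value :: "('a \<Rightarrow> real) \<Rightarrow> real" where
  "min_value f = (INF x. f x)"

(* The distances from points of the initial sublevel set to the minimizers. Their supremum in the
   reals is meaningful only together with bdd_above, which expresses that it is finite. *)
definition sublevel_dists :: "('a::euclidean_space \<Rightarrow> real) \<Rightarrow> 'a \<Rightarrow> real set" where
  "sublevel_dists f x0 = (\<lambda>x. infdist x (minimizers f)) ` {x. f x \<le> f x0}"

definition sublevel_radius :: "('a::euclidean_space \<Rightarrow> real) \<Rightarrow> 'a \<Rightarrow> real" where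
  "sublevel_radius f x0 = Sup (sublevel_dists f x0)"

definition tr_model :: "('a::euclidean_space \<Rightarrow> real) \<Rightarrow> 'a \<Rightarrow> 'a \<Rightarrow> real" where
  "tr_model f x s = f x + grad f x \<bullet> s + 1/2 * (blinfun_apply (hess f x) s \<bullet> s)"

definition tr_solution :: "('a::euclidean_space \<Rightarrow> real) \<Rightarrow> 'a \<Rightarrow> real \<Rightarrow> 'a \<Rightarrow> bool" where
  "tr_solution f x \<Delta> s \<longleftrightarrow> is_arg_min (tr_model f x) (\<lambda>s. norm s \<le> \<Delta>) s"

(* If the current gradient is nonzero, the steps allowed below have positive predicted decrease,
   so the denominator is positive. *)
definition tr_ratio :: "real \<Rightarrow> ('a::euclidean_space \<Rightarrow> real) \<Rightarrow> 'a \<Rightarrow> 'a \<Rightarrow> real" where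
  "tr_ratio \<theta> f x s =
     (f x - f (x + s)) /
     (tr_model f x 0 - tr_model f x s
        + \<theta> / 2 * min (norm (grad f x)) (norm (grad f (x + s))) * norm s)"

(* An infinite run, i.e. one in which the stopping test never succeeds.
   The accuracies tau and their bound taubar matter for the inexact variant only. *)
locale trust_region_run =
  fixes f :: "'a::euclidean_space \<Rightarrow> real"
    and \<theta> \<eta>1 \<eta>2 \<gamma>1 \<gamma>2 \<gamma>3 \<tau>bar :: real
    and \<tau> :: "nat \<Rightarrow> real"
    and x :: "nat \<Rightarrow> 'a"
    and \<Delta> :: "nat \<Rightarrow> real"
    and s :: "nat \<Rightarrow> 'a"
  assumes theta: "0 \<le> \<theta>"
    and eta: "0 < \<eta>1" "\<eta>1 \<le> \<eta>2" "\<eta>2 < 1"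
    and gamma: "0 < \<gamma>1" "\<gamma>1 \<le> \<gamma>2" "\<gamma>2 < 1" "1 \<le> \<gamma>3"
    and initial_radius: "0 < \<Delta> 0"
    and no_stop: "\<And>k. norm (grad f (x k)) > 0"
    and step_bound: "\<And>k. norm (s k) \<le> \<Delta> k"
    and step_variant:
      "(\<theta> = 0 \<and> 0 < \<tau>bar \<and>
         (\<forall>k. 0 \<le> \<tau> k \<and> \<tau> k < \<tau>bar \<and>
           (\<exists>s_opt. tr_solution f (x k) (\<Delta> k) s_opt \<and>
             tr_model f (x k) 0 - tr_model f (x k) (s k)
               \<ge> 1 / (1 + \<tau> k) * (tr_model f (x k) 0 - tr_model f (x k) s_opt))))
       \<or> (\<theta> > 0 \<and> (\<forall>k. tr_solution f (x k) (\<Delta> k) (s k)))"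
    and iterate_update:
      "\<And>k. x (Suc k) = (if tr_ratio \<theta> f (x k) (s k) \<ge> \<eta>1 then x k + s k else x k)"
    and radius_rejected:
      "\<And>k. tr_ratio \<theta> f (x k) (s k) < \<eta>1 \<Longrightarrow> \<Delta> (Suc k) \<in> {\<gamma>1 * \<Delta> k .. \<gamma>2 * \<Delta> k}"
    and radius_accepted:
      "\<And>k. \<eta>1 \<le> tr_ratio \<theta> f (x k) (s k) \<Longrightarrow> tr_ratio \<theta> f (x k) (s k) < \<eta>2 \<Longrightarrow>
         \<Delta> (Suc k) \<in> {\<gamma>2 * \<Delta> k .. \<Delta> k}"
    and radius_very_successful:
      "\<And>k. \<eta>2 \<le> tr_ratio \<theta> f (x k) (s k) \<Longrightarrow> \<Delta> (Suc k) \<in> {\<Delta> k .. \<gamma>3 * \<Delta> k}"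

end

theory Submission
  imports Defs
begin

text \<open>
  Let \<open>p\<close> be a minimizer nearest to \<open>x k\<close> and let \<open>r\<close> be the minimum in the claimed bound. The
  definition of \<open>\<beta>\<close> and the monotonicity of the objective values give \<open>r \<le> D\<close>, so the step
  \<open>(r / D) (p - x k)\<close> is feasible for the trial radius. Convexity bounds the true decrease along
  it from below by \<open>(r / D) F k\<close>, and the Hoelder condition on the Hessian bounds the model error by
  \<open>C\<^sub>f r\<^bsup>2 + \<nu>\<^esup>\<close>. By the second entry in the minimum defining \<open>\<beta>\<close>, this error uses up at most the
  fraction \<open>(1 - \<eta>2) / 2\<close> of the decrease.
\<close>

text \<open>The derivative is a linear functional, represented here as an inner product through the
  orthonormal basis. Uniqueness of derivatives then resolves the description operator in
  \<open>grad\<close>.\<close>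

lemma gderiv_grad:
  fixes f :: "'a::euclidean_space \<Rightarrow> real"
  assumes "f differentiable (at x)"
  shows "GDERIV f x :> grad f x"
proof -
  obtain f' where f': "(f has_derivative f') (at x)"
    using assms by (auto simp: differentiable_def)
  then have lin: "linear f'" by (rule has_derivative_linear)
  define g where "g = (\<Sum>b\<in>Basis. f' b *\<^sub>R b)"
  have "f' h = h \<bullet> g" for h
  proof -
    have "f' h = f' (\<Sum>b\<in>Basis. (h \<bullet> b) *\<^sub>R b)"
      by (simp add: euclidean_representation)
    also have "\<dots> = (\<Sum>b\<in>Basis. (h \<bullet> b) * f' b)"
      using lin by (simp add: linear_sum linear_cmul)
    also have "\<dots> = h \<bullet> g"
      by (simp add: g_def inner_sum_right mult.commute)
    finally show ?thesis .
  qed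
  then have "f' = (\<lambda>h. h \<bullet> g)" by auto
  with f' have g: "GDERIV f x :> g"
    by (simp add: gderiv_def)
  show ?thesis
    unfolding grad_def
  proof (rule theI[of _ g])
    show "GDERIV f x :> g" by (rule g)
    show "g' = g" if "GDERIV f x :> g'" for g'
    proof -
      have "(\<lambda>h. h \<bullet> g') = (\<lambda>h. h \<bullet> g)"
        using g that unfolding gderiv_def by (rule has_derivative_unique[rotated])
      then show ?thesis by (metis vector_eq_ldot)
    qed
  qed
qed

lemma has_derivative_hess:
  fixes f :: "'a::euclidean_space \<Rightarrow> real"
  assumes "grad f differentiable (at x)"
  shows "(grad f has_derivative blinfun_apply (hess f x)) (at x)"
proof -
  obtain G where G: "(grad f has_derivative G) (at x)"
    using assms by (auto simp: differentiable_def)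
  then have "bounded_linear G" by (rule has_derivative_bounded_linear)
  then have A: "(grad f has_derivative blinfun_apply (Blinfun G)) (at x)"
    using G by (simp add: bounded_linear_Blinfun_apply)
  show ?thesis
    unfolding hess_def
  proof (rule theI[of _ "Blinfun G"])
    show "(grad f has_derivative blinfun_apply (Blinfun G)) (at x)" by (rule A)
    show "B = Blinfun G" if "(grad f has_derivative blinfun_apply B) (at x)" for B
      using has_derivative_unique[OF that A] by (simp add: blinfun_apply_inject)
  qed
qed

lemma has_real_derivative_along_line:
  fixes f :: "'a::euclidean_space \<Rightarrow> real"
  assumes "f differentiable (at (x + t *\<^sub>R v))"
  shows "((\<lambda>t. f (x + t *\<^sub>R v)) has_real_derivative grad f (x + t *\<^sub>R v) \<bullet> v) (at t)"
proof -
  have "(f has_derivative (\<lambda>h. h \<bullet> grad f (x + t *\<^sub>R v))) (at (x + t *\<^sub>R v))"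
    using gderiv_grad[OF assms] by (simp add: gderiv_def)
  moreover have "((\<lambda>t. x + t *\<^sub>R v) has_derivative (\<lambda>h. h *\<^sub>R v)) (at t)"
    by (auto intro!: derivative_eq_intros)
  ultimately have "((\<lambda>t. f (x + t *\<^sub>R v)) has_derivative (\<lambda>h. (h *\<^sub>R v) \<bullet> grad f (x + t *\<^sub>R v))) (at t)"
    by (rule has_derivative_compose[rotated])
  then show ?thesis
    by (simp add: has_field_derivative_def inner_commute mult_commute_abs)
qed

lemma grad_along_line_has_real_derivative:
  fixes f :: "'a::euclidean_space \<Rightarrow> real"
  assumes "grad f differentiable (at (x + t *\<^sub>R v))"
  shows "((\<lambda>t. grad f (x + t *\<^sub>R v) \<bullet> w) has_real_derivative
           hess f (x + t *\<^sub>R v) v \<bullet> w) (at t)"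
proof -
  have "((\<lambda>t. x + t *\<^sub>R v) has_derivative (\<lambda>h. h *\<^sub>R v)) (at t)"
    by (auto intro!: derivative_eq_intros)
  from has_derivative_compose[OF this has_derivative_hess[OF assms]]
  have "((\<lambda>t. grad f (x + t *\<^sub>R v)) has_derivative (\<lambda>h. hess f (x + t *\<^sub>R v) (h *\<^sub>R v))) (at t)" .
  from has_derivative_inner_left[OF this, of w]
  show ?thesis
    by (simp add: has_field_derivative_def blinfun.scaleR_right mult_commute_abs)
qed

text \<open>One-sided Taylor estimate: the Hoelder bound on the second derivative along the segment
  from \<open>x\<close> to \<open>x + v\<close> is integrated twice. Each integration is carried out
  as a monotonicity argument for an auxiliary function.\<close>

lemma tr_model_le_holder:
  fixes f :: "'a::euclidean_space \<Rightarrow> real"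
  assumes smooth: "twice_cont_diff f" and "0 \<le> \<nu>"
    and holder: "\<And>y z. norm (hess f y - hess f z) \<le> L * norm (y - z) powr \<nu>"
  shows "tr_model f x v \<le> f (x + v) + L / ((1 + \<nu>) * (2 + \<nu>)) * norm v powr (2 + \<nu>)"
proof -
  have df: "f differentiable (at y)" and dg: "grad f differentiable (at y)" for y
    using smooth by (auto simp: twice_cont_diff_def)
  define K where "K = L * norm v powr (2 + \<nu>)"
  define q where "q = hess f x v \<bullet> v"
  \<comment> \<open>For positive arguments \<open>\<phi>\<close> is the derivative of
    \<open>\<psi>\<close>. The \<open>powr\<close> terms are the first and second antiderivatives of
    the error bound \<open>K * t powr \<nu>\<close>, both vanishing at 0.\<close>
  define \<phi> where "\<phi> t = (grad f (x + t *\<^sub>R v) - grad f x) \<bullet> v - t * q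
      + K / (1 + \<nu>) * t powr (1 + \<nu>)" for t
  define \<psi> where "\<psi> t = f (x + t *\<^sub>R v) - t * (grad f x \<bullet> v) - t\<^sup>2 / 2 * q
      + K / ((1 + \<nu>) * (2 + \<nu>)) * t powr (2 + \<nu>)" for t
  have cont_f: "continuous_on S (\<lambda>t. f (x + t *\<^sub>R v))" for S
    by (intro DERIV_continuous_on[where D = "\<lambda>t. grad f (x + t *\<^sub>R v) \<bullet> v"]
        DERIV_subset[OF has_real_derivative_along_line] df) auto
  have cont_g: "continuous_on S (\<lambda>t. grad f (x + t *\<^sub>R v) \<bullet> v)" for S
    by (intro DERIV_continuous_on[where D = "\<lambda>t. hess f (x + t *\<^sub>R v) v \<bullet> v"]
        DERIV_subset[OF grad_along_line_has_real_derivative] dg) auto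
  have curvature: "0 \<le> hess f (x + t *\<^sub>R v) v \<bullet> v - q + K * t powr \<nu>" if "0 < t" for t
  proof -
    have "- (hess f (x + t *\<^sub>R v) v \<bullet> v - q) \<le> \<bar>(hess f (x + t *\<^sub>R v) - hess f x) v \<bullet> v\<bar>"
      by (simp add: q_def blinfun.diff_left inner_diff_left)
    also have "\<dots> \<le> norm ((hess f (x + t *\<^sub>R v) - hess f x) v) * norm v"
      by (rule Cauchy_Schwarz_ineq2)
    also have "\<dots> \<le> (norm (hess f (x + t *\<^sub>R v) - hess f x) * norm v) * norm v"
      by (intro mult_right_mono norm_blinfun) auto
    also have "\<dots> \<le> (L * norm (t *\<^sub>R v) powr \<nu> * norm v) * norm v"
      using holder[of "x + t *\<^sub>R v" x] by (intro mult_right_mono) auto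
    \<comment> \<open>For \<open>v = 0\<close> both sides vanish; otherwise the two factors
      \<open>norm v\<close> merge into the exponent \<open>2 + \<nu>\<close>.\<close>
    also have "\<dots> = K * t powr \<nu>"
      using \<open>0 < t\<close> by (cases "v = 0") (simp_all add: K_def powr_mult powr_add power2_eq_square)
    finally show ?thesis by simp
  qed
  have phi_nonneg: "0 \<le> \<phi> t" if "0 < t" for t
  proof -
    have "\<phi> 0 \<le> \<phi> t"
    \<comment> \<open>This form asks for derivatives in the open interval only, so
      \<open>powr\<close> is never differentiated at base 0; continuity covers the endpoint.\<close>
    proof (rule DERIV_nonneg_imp_increasing_open[of 0 t])
      show "0 \<le> t" using that by simp
      show "\<exists>y. (\<phi> has_real_derivative y) (at u) \<and> 0 \<le> y" if "0 < u" "u < t" for u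
      proof (intro exI conjI)
        show "(\<phi> has_real_derivative (hess f (x + u *\<^sub>R v) v \<bullet> v - q + K * u powr \<nu>)) (at u)"
          unfolding \<phi>_def inner_diff_left
          using \<open>0 < u\<close> \<open>0 \<le> \<nu>\<close>
          by (auto intro!: derivative_eq_intros grad_along_line_has_real_derivative dg)
      qed (rule curvature[OF \<open>0 < u\<close>])
      show "continuous_on {0..t} \<phi>"
        unfolding \<phi>_def inner_diff_left
        using \<open>0 \<le> \<nu>\<close> by (intro continuous_intros cont_g continuous_on_powr') auto
    qed
    then show ?thesis by (simp add: \<phi>_def)
  qed
  \<comment> \<open>With the values of \<open>\<psi>\<close> inserted, this is the claimed
    estimate.\<close>
  have "\<psi> 0 \<le> \<psi> 1"
  proof (rule DERIV_nonneg_imp_increasing_open[of 0 1])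
    show "\<exists>y. (\<psi> has_real_derivative y) (at u) \<and> 0 \<le> y" if "0 < u" "u < 1" for u
    proof (intro exI conjI)
      have "K / ((1 + \<nu>) * (2 + \<nu>)) * ((2 + \<nu>) * u powr (1 + \<nu>)) = K / (1 + \<nu>) * u powr (1 + \<nu>)"
        using \<open>0 \<le> \<nu>\<close> by (simp add: divide_simps)
      then show "(\<psi> has_real_derivative \<phi> u) (at u)"
        unfolding \<psi>_def \<phi>_def inner_diff_left
        using \<open>0 < u\<close> \<open>0 \<le> \<nu>\<close>
        by (auto intro!: derivative_eq_intros has_real_derivative_along_line df simp: add.commute)
    qed (rule phi_nonneg[OF \<open>0 < u\<close>])
    show "continuous_on {0..1} \<psi>"
      unfolding \<psi>_def
      using \<open>0 \<le> \<nu>\<close> by (intro continuous_intros cont_f continuous_on_powr') auto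
  qed simp
  then show ?thesis
    by (simp add: \<psi>_def tr_model_def K_def q_def)
qed

text \<open>A feasible \<open>v\<close> forces \<open>0 \<le> r\<close>, so the zero step is
  feasible too and competes with \<open>v\<close>.\<close>

lemma tr_model_solution_le:
  assumes "tr_solution f x r v"
  shows "tr_model f x v \<le> tr_model f x 0"
proof -
  have "norm v \<le> r" using assms by (simp add: tr_solution_def is_arg_min_def)
  then have "0 \<le> r" using norm_ge_zero[of v] by linarith
  then show ?thesis
    using assms by (auto simp: tr_solution_def is_arg_min_linorder)
qed

text \<open>The exact variant is the previous lemma; the inexact one guarantees a nonnegative
  multiple of the optimal decrease, which is itself nonnegative.\<close>

lemma (in trust_region_run) tr_model_step_le: "tr_model f (x j) (s j) \<le> tr_model f (x j) 0"
  using step_variant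
proof (elim disjE conjE)
  assume "\<forall>k. 0 \<le> \<tau> k \<and> \<tau> k < \<tau>bar \<and>
           (\<exists>s_opt. tr_solution f (x k) (\<Delta> k) s_opt \<and>
             tr_model f (x k) 0 - tr_model f (x k) (s k)
               \<ge> 1 / (1 + \<tau> k) * (tr_model f (x k) 0 - tr_model f (x k) s_opt))"
  then obtain s_opt where "0 \<le> \<tau> j" and opt: "tr_solution f (x j) (\<Delta> j) s_opt"
    and dec: "tr_model f (x j) 0 - tr_model f (x j) (s j)
               \<ge> 1 / (1 + \<tau> j) * (tr_model f (x j) 0 - tr_model f (x j) s_opt)"
    by blast
  have "0 \<le> 1 / (1 + \<tau> j) * (tr_model f (x j) 0 - tr_model f (x j) s_opt)"
    using \<open>0 \<le> \<tau> j\<close> tr_model_solution_le[OF opt] by (intro mult_nonneg_nonneg) auto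
  with dec show ?thesis by linarith
qed (blast intro: tr_model_solution_le)

lemma (in trust_region_run) objective_le_initial: "f (x j) \<le> f (x 0)"
proof (induction j)
  case (Suc j)
  have "f (x (Suc j)) \<le> f (x j)"
  proof (cases "\<eta>1 \<le> tr_ratio \<theta> f (x j) (s j)")
    case True
    \<comment> \<open>A positive quotient with nonnegative denominator has a positive numerator; a
      zero denominator is excluded because division by zero yields 0.\<close>
    have "0 \<le> tr_model f (x j) 0 - tr_model f (x j) (s j)
        + \<theta> / 2 * min (norm (grad f (x j))) (norm (grad f (x j + s j))) * norm (s j)"
      using tr_model_step_le[of j] theta by (intro add_nonneg_nonneg mult_nonneg_nonneg) auto
    moreover have "0 < tr_ratio \<theta> f (x j) (s j)"
      using True eta(1) by linarith
    ultimately have "0 < f (x j) - f (x j + s j)"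
      unfolding tr_ratio_def zero_less_divide_iff by linarith
    with True show ?thesis by (simp add: iterate_update)
  next
    case False
    then show ?thesis by (simp add: iterate_update)
  qed
  with Suc.IH show ?case by linarith
qed simp

lemma min_value_eq:
  assumes "p \<in> minimizers f"
  shows "min_value f = (f p :: real)"
  using assms unfolding minimizers_def min_value_def is_arg_min_linorder
  by (intro cInf_eq_minimum) auto

text \<open>An intersection of closed sublevel sets. Closedness is what makes the distance to the
  minimizers attained.\<close>

lemma closed_minimizers:
  fixes f :: "'a::topological_space \<Rightarrow> real"
  assumes "continuous_on UNIV f"
  shows "closed (minimizers f)"
proof -
  have "minimizers f = (\<Inter>y. {z. f z \<le> f y})"
    by (auto simp: minimizers_def is_arg_min_linorder)
  then show ?thesis
    using assms by (auto intro!: closed_Collect_le)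
qed

theorem lemma7:
  fixes f :: "'a::euclidean_space \<Rightarrow> real"
    and L \<nu> :: real
    and \<theta> \<eta>1 \<eta>2 \<gamma>1 \<gamma>2 \<gamma>3 \<tau>bar :: real
    and \<tau> :: "nat \<Rightarrow> real"
    and x :: "nat \<Rightarrow> 'a"
    and \<Delta> :: "nat \<Rightarrow> real"
    and s :: "nat \<Rightarrow> 'a"
    and k :: nat
    and R :: real
    and s_R :: 'a
  assumes "convex_on UNIV f"
    and "twice_cont_diff f"
    and "bdd_below (range f)"
    and "minimizers f \<noteq> {}"
    and "L > 0"
    and "0 \<le> \<nu>" and "\<nu> \<le> 1"
    and "\<And>y z. norm (hess f y - hess f z) \<le> L * norm (y - z) powr \<nu>"
    and "bdd_above (sublevel_dists f (x 0))"
    and "trust_region_run f \<theta> \<eta>1 \<eta>2 \<gamma>1 \<gamma>2 \<gamma>3 \<tau>bar \<tau> x \<Delta> s"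
    and "\<And>j. f (x j) - min_value f > 0"
    and "R > 0"
    and "tr_solution f (x k) R s_R"
  shows "let D = sublevel_radius f (x 0);
             F = (\<lambda>j. f (x j) - min_value f);
             \<alpha> = 1 / (1 + \<nu>);
             C\<^sub>f = L / ((1 + \<nu>) * (2 + \<nu>));
             \<beta> = min (D / F 0 powr \<alpha>) (((1 - \<eta>2) / (2 * C\<^sub>f * D)) powr \<alpha>)
         in tr_model f (x k) 0 - tr_model f (x k) s_R
              \<ge> (1 + \<eta>2) * F k / (2 * D) * min (\<beta> * F k powr \<alpha>) R"
proof -
  interpret trust_region_run f \<theta> \<eta>1 \<eta>2 \<gamma>1 \<gamma>2 \<gamma>3 \<tau>bar \<tau> x \<Delta> s by (rule assms(10))
  define D where "D = sublevel_radius f (x 0)"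
  define F where "F j = f (x j) - min_value f" for j
  define \<alpha> where "\<alpha> = 1 / (1 + \<nu>)"
  define C where "C = L / ((1 + \<nu>) * (2 + \<nu>))"
  define \<beta> where "\<beta> = min (D / F 0 powr \<alpha>) (((1 - \<eta>2) / (2 * C * D)) powr \<alpha>)"
  define r where "r = min (\<beta> * F k powr \<alpha>) R"
  have F_pos: "0 < F j" for j using assms(11) by (simp add: F_def)
  have F_le: "F k \<le> F 0" using objective_le_initial by (simp add: F_def)
  have "0 < \<alpha>" and \<alpha>_inv: "\<alpha> * (1 + \<nu>) = 1" using \<open>0 \<le> \<nu>\<close> by (simp_all add: \<alpha>_def)
  have "0 < C" using \<open>0 < L\<close> \<open>0 \<le> \<nu>\<close> by (simp add: C_def)

  have "continuous_on UNIV f"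
    using assms(2) by (auto simp: twice_cont_diff_def continuous_at_imp_continuous_on
        differentiable_imp_continuous_within)
  then obtain p where p: "p \<in> minimizers f" "infdist (x k) (minimizers f) = dist (x k) p"
    using infdist_attains_inf[OF closed_minimizers assms(4)] by metis
  have fp: "min_value f = f p" using p(1) by (rule min_value_eq)
  \<comment> \<open>Objective values never exceed the initial one, so \<open>x k\<close> lies in the
    sublevel set over which \<open>D\<close> is the supremum.\<close>
  have dist_le: "norm (p - x k) \<le> D"
    unfolding D_def sublevel_radius_def
    using p(2) objective_le_initial
    by (intro cSup_upper assms(9)) (auto simp: sublevel_dists_def dist_norm norm_minus_commute
        intro!: image_eqI[of _ _ "x k"])
  moreover have "p \<noteq> x k" using F_pos[of k] by (auto simp: F_def fp)
  then have "0 < norm (p - x k)" by simp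
  ultimately have "0 < D" by linarith

  have "0 < \<beta>"
    using \<open>0 < D\<close> \<open>0 < C\<close> F_pos[of 0] eta(3) by (auto simp: \<beta>_def)
  then have "0 < r" using F_pos[of k] \<open>R > 0\<close> by (auto simp: r_def)
  have "r \<le> \<beta> * F k powr \<alpha>" by (simp add: r_def)
  also have "\<dots> \<le> D / F 0 powr \<alpha> * F 0 powr \<alpha>"
    using \<open>0 < \<alpha>\<close> \<open>0 < D\<close> F_le F_pos[of k] \<open>0 < \<beta>\<close>
    by (intro mult_mono powr_mono2) (auto simp: \<beta>_def)
  finally have "r \<le> D" using F_pos[of 0] by simp
  \<comment> \<open>The second entry of \<open>\<beta>\<close> enters here; the power
    \<open>1 + \<nu>\<close> cancels the exponent \<open>\<alpha>\<close>.\<close>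
  have "r powr (1 + \<nu>) \<le> (((1 - \<eta>2) / (2 * C * D)) powr \<alpha> * F k powr \<alpha>) powr (1 + \<nu>)"
    using \<open>0 < r\<close> \<open>0 \<le> \<nu>\<close>
    by (intro powr_mono2 order_trans[OF \<open>r \<le> \<beta> * F k powr \<alpha>\<close>] mult_right_mono) (auto simp: \<beta>_def)
  also have "\<dots> = (1 - \<eta>2) / (2 * C * D) * F k"
    using \<open>0 < D\<close> \<open>0 < C\<close> F_pos[of k] eta(3) by (simp add: powr_mult powr_powr \<alpha>_inv)
  finally have r_powr: "C * r powr (1 + \<nu>) \<le> (1 - \<eta>2) * F k / (2 * D)"
    using \<open>0 < C\<close> \<open>0 < D\<close> by (simp add: field_simps)

  \<comment> \<open>Scaling by \<open>D\<close> instead of the actual distance to \<open>p\<close>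
    keeps \<open>norm v\<close> below \<open>r\<close> and makes the decrease guaranteed by
    convexity exactly \<open>t * F k\<close>.\<close>
  define t where "t = r / D"
  define v where "v = t *\<^sub>R (p - x k)"
  have t: "0 < t" "t \<le> 1" using \<open>0 < r\<close> \<open>0 < D\<close> \<open>r \<le> D\<close> by (simp_all add: t_def)
  have "norm v \<le> t * D" using t dist_le by (simp add: v_def)
  then have "norm v \<le> r" using \<open>0 < D\<close> by (simp add: t_def)
  then have "norm v \<le> R" by (simp add: r_def)
  then have "tr_model f (x k) s_R \<le> tr_model f (x k) v"
    using assms(13) by (simp add: tr_solution_def is_arg_min_linorder)
  also have "\<dots> \<le> f (x k + v) + C * norm v powr (2 + \<nu>)"
    unfolding C_def by (rule tr_model_le_holder[OF assms(2,6,8)])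
  also have "\<dots> \<le> (1 - t) * f (x k) + t * f p + C * r powr (2 + \<nu>)"
  proof (rule add_mono)
    have "x k + v = (1 - t) *\<^sub>R x k + t *\<^sub>R p" by (simp add: v_def algebra_simps)
    then show "f (x k + v) \<le> (1 - t) * f (x k) + t * f p"
      using convex_onD[OF assms(1), of t "x k" p] t by simp
    show "C * norm v powr (2 + \<nu>) \<le> C * r powr (2 + \<nu>)"
      using \<open>norm v \<le> r\<close> \<open>0 < C\<close> \<open>0 \<le> \<nu>\<close> by (intro mult_left_mono powr_mono2) auto
  qed
  \<comment> \<open>Splitting off one factor \<open>r\<close> makes the error comparable with the
    decrease \<open>r * F k / D\<close>, which is linear in \<open>r\<close>.\<close>
  also have "C * r powr (2 + \<nu>) = r * (C * r powr (1 + \<nu>))"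
    using \<open>0 < r\<close> powr_mult_base[of r "1 + \<nu>"] by (simp add: algebra_simps)
  also have "(1 - t) * f (x k) + t * f p + r * (C * r powr (1 + \<nu>))
      \<le> (1 - t) * f (x k) + t * f p + r * ((1 - \<eta>2) * F k / (2 * D))"
    using r_powr \<open>0 < r\<close> by (intro add_left_mono mult_left_mono) auto
  \<comment> \<open>The constant arises as
    \<open>1 - (1 - \<eta>2) / 2 = (1 + \<eta>2) / 2\<close>.\<close>
  also have "\<dots> = f (x k) - (1 + \<eta>2) * F k / (2 * D) * r"
    using \<open>0 < D\<close> by (simp add: t_def F_def fp field_simps)
  finally have "tr_model f (x k) 0 - tr_model f (x k) s_R \<ge> (1 + \<eta>2) * F k / (2 * D) * r"
    by (simp add: tr_model_def)
  then show ?thesis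
    by (simp add: Let_def D_def F_def \<alpha>_def C_def \<beta>_def r_def)
qed

end
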